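(* Let $G$ be a group and let $H$ and $K$ be nilpotent normal subgroups of $G$. Then the subgroup $H \sqcup K$ of $G$ generated by $H$ and $K$ is nilpotent. Moreover, if $H$ has nilpotency class $h$ and $K$ has nilpotency class $k$, then $H \sqcup K$ has nilpotency class at most $h+k$.
   Context: For subgroups $A, B$ of a group, $[A,B]$ denotes the subgroup generated by all commutators $[a,b] = a b a^{-1} b^{-1}$ with $a \in A$ and $b \in B$. The lower central series of a group $\Gamma$ is defined by $\Gamma_0 = \Gamma$ and $\Gamma_{i+1} = [\Gamma_i, \Gamma]$ for $i \ge 0$. The group $\Gamma$ is nilpotent if $\Gamma_n = \{1\}$ for some $n \ge 0$; the smallest such $n$ is its nilpotency class. A subgroup is called nilpotent (of a given class) if it is nilpotent (of that class) when considered as a group in its own right. The group $G$ is arbitrary (not assumed finite). *)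

theory Defs
  imports "HOL-Algebra.Generated_Groups"
begin

definition commutator_subgroup :: "('a, 'b) monoid_scheme \<Rightarrow> 'a set \<Rightarrow> 'a set \<Rightarrow> 'a set" where
  "commutator_subgroup G A B =
     generate G (\<Union>a\<in>A. \<Union>b\<in>B. {a \<otimes>\<^bsub>G\<^esub> b \<otimes>\<^bsub>G\<^esub> inv\<^bsub>G\<^esub> a \<otimes>\<^bsub>G\<^esub> inv\<^bsub>G\<^esub> b})"

primrec lower_central :: "('a, 'b) monoid_scheme \<Rightarrow> nat \<Rightarrow> 'a set" where
  "lower_central G 0 = carrier G"
| "lower_central G (Suc i) = commutator_subgroup G (lower_central G i) (carrier G)"

definition nilpotent_group :: "('a, 'b) monoid_scheme \<Rightarrow> bool" where
  "nilpotent_group G \<longleftrightarrow> group G \<and> (\<exists>n. lower_central G n = {\<one>\<^bsub>G\<^esub>})"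

text \<open>Meaningful for nilpotent groups only: otherwise the least element is unspecified.\<close>

definition nilpotency_class :: "('a, 'b) monoid_scheme \<Rightarrow> nat" where
  "nilpotency_class G = (LEAST n. lower_central G n = {\<one>\<^bsub>G\<^esub>})"

end

theory Submission
  imports Defs
begin

text \<open>
  This is Fitting's theorem. Number the lower central series of a normal subgroup \<open>N\<close> from one and
  put the whole group in front: \<open>N\<^sup>0 = G\<close>, \<open>N\<^sup>1 = N\<close>, \<open>N\<^sup>2 = [N, N]\<close>, and so on. Then every
  \<open>N\<^sup>i\<close> is normal in \<open>G\<close>, and \<open>[N\<^sup>i, N] \<subseteq> N\<^bsup>i+1\<^esup>\<close> holds for all \<open>i\<close>, the case \<open>i = 0\<close> being
  the normality of \<open>N\<close> (lemma \<open>commutator_extended_series\<close>).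

  Let \<open>M\<^sub>n\<close> be the subgroup generated by all \<open>H\<^sup>i \<inter> K\<^sup>j\<close> with \<open>i + j = n\<close>. Commuting an element of
  \<open>H\<^sup>i \<inter> K\<^sup>j\<close> with one of \<open>H\<close> raises \<open>i\<close> by one and stays in \<open>K\<^sup>j\<close>, since \<open>K\<^sup>j\<close> is normal; the
  same holds with \<open>H\<close> and \<open>K\<close> exchanged. Because \<open>M\<^bsub>n+1\<^esub>\<close> is normal, it is enough to look at
  commutators of generators, so \<open>[M\<^sub>n, H \<squnion> K] \<subseteq> M\<^bsub>n+1\<^esub>\<close>. As \<open>H \<squnion> K \<subseteq> M\<^sub>1\<close>, induction places the
  \<open>n\<close>-th term of the lower central series of \<open>H \<squnion> K\<close> inside \<open>M\<^bsub>n+1\<^esub>\<close>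
  (lemma \<open>lower_central_join_subset\<close>).

  If \<open>H\<close> and \<open>K\<close> have classes \<open>h\<close> and \<open>k\<close>, then \<open>i + j = h + k + 1\<close> forces \<open>i > h\<close> or \<open>j > k\<close>.
  So each \<open>H\<^sup>i \<inter> K\<^sup>j\<close> generating \<open>M\<^bsub>h+k+1\<^esub>\<close> is trivial, which bounds the class by \<open>h + k\<close>.
\<close>

section \<open>Commutators modulo a normal subgroup\<close>

abbreviation commutator :: "('a, 'b) monoid_scheme \<Rightarrow> 'a \<Rightarrow> 'a \<Rightarrow> 'a" where
  "commutator G a b \<equiv> a \<otimes>\<^bsub>G\<^esub> b \<otimes>\<^bsub>G\<^esub> inv\<^bsub>G\<^esub> a \<otimes>\<^bsub>G\<^esub> inv\<^bsub>G\<^esub> b"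

context group
begin

lemma inv_mult_cancel_left:
  assumes "x \<in> carrier G" "y \<in> carrier G"
  shows "inv x \<otimes> (x \<otimes> y) = y" "x \<otimes> (inv x \<otimes> y) = y"
  using assms by (simp_all flip: m_assoc)

lemmas group_word_simps = m_assoc inv_mult_group inv_mult_cancel_left

lemma inv_commutator:
  assumes "x \<in> carrier G" "y \<in> carrier G"
  shows "inv (commutator G x y) = commutator G y x"
  using assms by (simp add: group_word_simps)

lemma commutator_mult_left:
  assumes "x \<in> carrier G" "y \<in> carrier G" "b \<in> carrier G"
  shows "commutator G (x \<otimes> y) b = (x \<otimes> commutator G y b \<otimes> inv x) \<otimes> commutator G x b"
  using assms by (simp add: group_word_simps)

lemma commutator_inv_left:
  assumes "x \<in> carrier G" "b \<in> carrier G"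
  shows "commutator G (inv x) b = inv x \<otimes> inv (commutator G x b) \<otimes> x"
  using assms by (simp add: group_word_simps)

lemma conjugate_commutator:
  assumes "g \<in> carrier G" "x \<in> carrier G" "y \<in> carrier G"
  shows "g \<otimes> commutator G x y \<otimes> inv g = commutator G (g \<otimes> x \<otimes> inv g) (g \<otimes> y \<otimes> inv g)"
  using assms by (simp add: group_word_simps)

text \<open>The left-hand set is the centralizer of \<open>B\<close> modulo \<open>N\<close>.\<close>

lemma subgroup_centralizer_mod:
  assumes N: "N \<lhd> G" and B: "B \<subseteq> carrier G"
  shows "subgroup {x \<in> carrier G. \<forall>b\<in>B. commutator G x b \<in> N} G"
proof -
  interpret N: normal N G by (rule N)
  show ?thesis
  proof (rule subgroupI)
    have "commutator G \<one> b \<in> N" if "b \<in> B" for b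
      using that B by (simp add: subset_iff)
    thus "{x \<in> carrier G. \<forall>b\<in>B. commutator G x b \<in> N} \<noteq> {}"
      by blast
  next
    fix x assume x: "x \<in> {x \<in> carrier G. \<forall>b\<in>B. commutator G x b \<in> N}"
    have "commutator G (inv x) b \<in> N" if b: "b \<in> B" for b
    proof -
      have "inv x \<otimes> inv (commutator G x b) \<otimes> x \<in> N"
        using x b by (intro N.inv_op_closed1 N.m_inv_closed) auto
      thus ?thesis
        using x b B commutator_inv_left[of x b] by (simp add: subset_iff)
    qed
    thus "inv x \<in> {x \<in> carrier G. \<forall>b\<in>B. commutator G x b \<in> N}"
      using x by blast
  next
    fix x y
    assume "x \<in> {x \<in> carrier G. \<forall>b\<in>B. commutator G x b \<in> N}"
      and "y \<in> {x \<in> carrier G. \<forall>b\<in>B. commutator G x b \<in> N}"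
    thus "x \<otimes> y \<in> {x \<in> carrier G. \<forall>b\<in>B. commutator G x b \<in> N}"
      using B N.inv_op_closed2 N.m_closed by (auto simp: commutator_mult_left subset_iff)
  qed blast
qed

lemma commutator_generate_left:
  assumes "N \<lhd> G" "A \<subseteq> carrier G" "B \<subseteq> carrier G"
    and "\<And>a b. a \<in> A \<Longrightarrow> b \<in> B \<Longrightarrow> commutator G a b \<in> N"
    and "x \<in> generate G A" "b \<in> B"
  shows "commutator G x b \<in> N"
proof -
  have "A \<subseteq> {x \<in> carrier G. \<forall>b\<in>B. commutator G x b \<in> N}"
    using assms(2,4) by blast
  from generate_subgroup_incl[OF this subgroup_centralizer_mod[OF assms(1,3)]]
  show ?thesis using assms(5,6) by blast
qed

text \<open>
  Centralizing modulo a normal subgroup is a symmetric relation, so the passage from generators to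
  the generated subgroup can be made in one argument and then in the other.
\<close>

lemma commutator_subgroup_generate_subset:
  assumes N: "N \<lhd> G" and A: "A \<subseteq> carrier G" and B: "B \<subseteq> carrier G"
    and AB: "\<And>a b. a \<in> A \<Longrightarrow> b \<in> B \<Longrightarrow> commutator G a b \<in> N"
  shows "commutator_subgroup G (generate G A) (generate G B) \<subseteq> N"
proof -
  interpret N: normal N G by (rule N)
  have swap: "commutator G y x \<in> N"
    if "commutator G x y \<in> N" "x \<in> carrier G" "y \<in> carrier G" for x y
    using N.m_inv_closed[OF that(1)] inv_commutator[OF that(2,3)] by simp
  have gA: "generate G A \<subseteq> carrier G" and gB: "generate G B \<subseteq> carrier G"
    using A B by (simp_all add: generate_incl)
  have 1: "commutator G x b \<in> N" if "x \<in> generate G A" "b \<in> B" for x b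
    using commutator_generate_left[OF N A B AB that] .
  have 2: "commutator G b x \<in> N" if "b \<in> B" "x \<in> generate G A" for b x
    using swap[OF 1[OF that(2,1)]] that gA B by blast
  have "commutator G x y \<in> N" if "x \<in> generate G A" "y \<in> generate G B" for x y
    using swap[OF commutator_generate_left[OF N B gA 2 that(2,1)]] that gA gB by blast
  thus ?thesis
    unfolding commutator_subgroup_def
    by (intro generate_subgroup_incl N.subgroup_axioms) blast
qed

lemma commutator_subgroup_normal:
  assumes A: "A \<lhd> G" and B: "B \<lhd> G"
  shows "commutator_subgroup G A B \<lhd> G"
proof -
  interpret A: normal A G by (rule A)
  interpret B: normal B G by (rule B)
  show ?thesis
    unfolding commutator_subgroup_def
  proof (rule normal_generateI)
    show "(\<Union>a\<in>A. \<Union>b\<in>B. {commutator G a b}) \<subseteq> carrier G"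
      by (auto intro: A.mem_carrier B.mem_carrier)
  next
    fix x g assume "x \<in> (\<Union>a\<in>A. \<Union>b\<in>B. {commutator G a b})" and g: "g \<in> carrier G"
    then obtain a b where ab: "a \<in> A" "b \<in> B" and x: "x = commutator G a b"
      by blast
    have "g \<otimes> x \<otimes> inv g = commutator G (g \<otimes> a \<otimes> inv g) (g \<otimes> b \<otimes> inv g)"
      unfolding x using g ab by (intro conjugate_commutator) auto
    thus "g \<otimes> x \<otimes> inv g \<in> (\<Union>a\<in>A. \<Union>b\<in>B. {commutator G a b})"
      using A.inv_op_closed2[OF g ab(1)] B.inv_op_closed2[OF g ab(2)] by blast
  qed
qed

lemma commutator_subgroup_subset_right:
  assumes A: "A \<subseteq> carrier G" and N: "N \<lhd> G"
  shows "commutator_subgroup G A N \<subseteq> N"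
proof -
  interpret N: normal N G by (rule N)
  have "commutator G a b \<in> N" if "a \<in> A" "b \<in> N" for a b
    using N.m_closed[OF N.inv_op_closed2 N.m_inv_closed] that A by blast
  thus ?thesis
    unfolding commutator_subgroup_def
    by (intro generate_subgroup_incl N.subgroup_axioms) blast
qed

lemma commutator_subgroup_consistent:
  assumes H: "subgroup H G" and "A \<subseteq> H" "B \<subseteq> H"
  shows "commutator_subgroup (G\<lparr>carrier := H\<rparr>) A B = commutator_subgroup G A B"
proof -
  interpret H: subgroup H G by (rule H)
  have "inv\<^bsub>G\<lparr>carrier := H\<rparr>\<^esub> x = inv x" if "x \<in> H" for x
    using m_inv_consistent[OF H that] .
  hence "(\<Union>a\<in>A. \<Union>b\<in>B. {commutator (G\<lparr>carrier := H\<rparr>) a b}) = (\<Union>a\<in>A. \<Union>b\<in>B. {commutator G a b})"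
    using assms(2,3) by (auto simp: subset_iff)
  moreover have "(\<Union>a\<in>A. \<Union>b\<in>B. {commutator G a b}) \<subseteq> H"
    using assms(2,3) by (auto simp: subset_iff)
  ultimately show ?thesis
    unfolding commutator_subgroup_def using generate_consistent[OF _ H] by simp
qed

section \<open>Lower central series of subgroups\<close>

lemma subgroup_lower_central: "subgroup (lower_central G n) G"
proof (induction n)
  case 0
  show ?case by (simp add: subgroup_self)
next
  case (Suc n)
  have "(\<Union>a\<in>lower_central G n. \<Union>b\<in>carrier G. {commutator G a b}) \<subseteq> carrier G"
    using subgroup.subset[OF Suc] by (auto simp: subset_iff)
  thus ?case
    by (simp add: commutator_subgroup_def generate_is_subgroup)
qed

lemma lower_central_trivial_mono:
  assumes "lower_central G m = {\<one>}" and "m \<le> n"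
  shows "lower_central G n = {\<one>}"
  using assms(2)
proof (induction n rule: dec_induct)
  case base
  show ?case by (rule assms(1))
next
  case (step n)
  have "commutator_subgroup G {\<one>} (carrier G) \<subseteq> generate G {\<one>}"
    unfolding commutator_subgroup_def by (rule mono_generate) auto
  hence "lower_central G (Suc n) \<subseteq> {\<one>}"
    using step.IH generate_one by simp
  thus ?case
    using subgroup.one_closed[OF subgroup_lower_central] by blast
qed

lemma lower_central_subgroup_Suc:
  assumes H: "subgroup H G"
  shows "lower_central (G\<lparr>carrier := H\<rparr>) (Suc n) =
    commutator_subgroup G (lower_central (G\<lparr>carrier := H\<rparr>) n) H"
proof -
  have "lower_central (G\<lparr>carrier := H\<rparr>) n \<subseteq> H"
    using subgroup.subset[OF group.subgroup_lower_central[OF subgroup_imp_group[OF H]]] by simp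
  thus ?thesis
    using commutator_subgroup_consistent[OF H] by simp
qed

lemma lower_central_normal:
  assumes N: "N \<lhd> G"
  shows "lower_central (G\<lparr>carrier := N\<rparr>) n \<lhd> G"
proof (induction n)
  case 0
  show ?case using N by simp
next
  case (Suc n)
  thus ?case
    using commutator_subgroup_normal[OF _ N] lower_central_subgroup_Suc normal_imp_subgroup[OF N]
    by presburger
qed

end

section \<open>The join of two normal subgroups\<close>

text \<open>
  The lower central series of \<open>N\<close>, preceded by \<open>G\<close>: with this shift the index of an intersection of
  two such terms is additive, and the factors \<open>H = H \<inter> G\<close> and \<open>K = G \<inter> K\<close> themselves have index 1.
\<close>

definition extended_series :: "('a, 'b) monoid_scheme \<Rightarrow> 'a set \<Rightarrow> nat \<Rightarrow> 'a set" where
  "extended_series G N i =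
    (case i of 0 \<Rightarrow> carrier G | Suc j \<Rightarrow> lower_central (G\<lparr>carrier := N\<rparr>) j)"

definition mixed_terms :: "('a, 'b) monoid_scheme \<Rightarrow> 'a set \<Rightarrow> 'a set \<Rightarrow> nat \<Rightarrow> 'a set" where
  "mixed_terms G H K n =
    (\<Union>(i, j) \<in> {(i, j). i + j = n}. extended_series G H i \<inter> extended_series G K j)"

lemma mem_mixed_terms:
  "x \<in> mixed_terms G H K n \<longleftrightarrow>
    (\<exists>i j. i + j = n \<and> x \<in> extended_series G H i \<and> x \<in> extended_series G K j)"
  unfolding mixed_terms_def by auto

context group
begin

lemma extended_series_normal: "N \<lhd> G \<Longrightarrow> extended_series G N i \<lhd> G"
  unfolding extended_series_def
  by (auto split: nat.split intro: normal_self lower_central_normal)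

text \<open>
  At \<open>i = 0\<close> this is the normality of \<open>N\<close>; from then on it is the recursion of the lower central series.
\<close>

lemma commutator_extended_series:
  assumes N: "N \<lhd> G" and x: "x \<in> extended_series G N i" and y: "y \<in> N"
  shows "commutator G x y \<in> extended_series G N (Suc i)"
proof -
  have "commutator G x y \<in> commutator_subgroup G (extended_series G N i) N"
    unfolding commutator_subgroup_def using x y by (blast intro: generate.incl)
  moreover have "commutator_subgroup G (extended_series G N i) N \<subseteq> extended_series G N (Suc i)"
  proof (cases i)
    case 0
    thus ?thesis
      using commutator_subgroup_subset_right[OF subset_refl N] by (simp add: extended_series_def)
  next
    case (Suc j)
    thus ?thesis
      using lower_central_subgroup_Suc[OF normal_imp_subgroup[OF N], of j]
      by (simp add: extended_series_def del: lower_central.simps)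
  qed
  ultimately show ?thesis by blast
qed

lemma commutator_mem_normal_left:
  assumes N: "N \<lhd> G" and x: "x \<in> N" and y: "y \<in> carrier G"
  shows "commutator G x y \<in> N"
proof -
  interpret N: normal N G by (rule N)
  have "commutator G x y = x \<otimes> (y \<otimes> inv x \<otimes> inv y)"
    using N.mem_carrier[OF x] y by (simp add: m_assoc)
  thus ?thesis
    using N.m_closed[OF x N.inv_op_closed2[OF y N.m_inv_closed[OF x]]] by simp
qed

lemma mixed_terms_subset: "H \<lhd> G \<Longrightarrow> mixed_terms G H K n \<subseteq> carrier G"
  using subgroup.subset[OF normal_imp_subgroup[OF extended_series_normal]]
  unfolding mixed_terms_def by blast

lemma generate_mixed_terms_normal:
  assumes H: "H \<lhd> G" and K: "K \<lhd> G"
  shows "generate G (mixed_terms G H K n) \<lhd> G"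
proof (rule normal_generateI)
  show "mixed_terms G H K n \<subseteq> carrier G"
    by (rule mixed_terms_subset[OF H])
next
  fix x g assume "x \<in> mixed_terms G H K n" and "g \<in> carrier G"
  thus "g \<otimes> x \<otimes> inv g \<in> mixed_terms G H K n"
    using normal.inv_op_closed2[OF extended_series_normal[OF H]]
      normal.inv_op_closed2[OF extended_series_normal[OF K]]
    unfolding mem_mixed_terms by blast
qed

text \<open>
  A factor from \<open>H\<close> pushes the commutator one step down the series of \<open>H\<close>, while normality alone keeps
  it in the current term of the series of \<open>K\<close>; for a factor from \<open>K\<close> the roles are exchanged. Either
  way the index sum grows by one.
\<close>

lemma commutator_mixed_terms:
  assumes H: "H \<lhd> G" and K: "K \<lhd> G"
    and x: "x \<in> mixed_terms G H K n" and y: "y \<in> H \<union> K"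
  shows "commutator G x y \<in> mixed_terms G H K (Suc n)"
proof -
  obtain i j where ij: "i + j = n"
    and xH: "x \<in> extended_series G H i" and xK: "x \<in> extended_series G K j"
    using x unfolding mem_mixed_terms by blast
  have carr: "y \<in> carrier G"
    using y H[THEN normal_imp_subgroup, THEN subgroup.subset]
      K[THEN normal_imp_subgroup, THEN subgroup.subset] by blast
  from y show ?thesis
  proof
    assume "y \<in> H"
    hence "commutator G x y \<in> extended_series G H (Suc i)"
      using commutator_extended_series[OF H xH] by blast
    moreover have "commutator G x y \<in> extended_series G K j"
      by (rule commutator_mem_normal_left[OF extended_series_normal[OF K] xK carr])
    moreover have "Suc i + j = Suc n"
      using ij by simp
    ultimately show ?thesis
      unfolding mem_mixed_terms by blast
  next
    assume "y \<in> K"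
    hence "commutator G x y \<in> extended_series G K (Suc j)"
      using commutator_extended_series[OF K xK] by blast
    moreover have "commutator G x y \<in> extended_series G H i"
      by (rule commutator_mem_normal_left[OF extended_series_normal[OF H] xH carr])
    moreover have "i + Suc j = Suc n"
      using ij by simp
    ultimately show ?thesis
      unfolding mem_mixed_terms by blast
  qed
qed

text \<open>
  The inductive step only has to treat commutators of mixed terms with elements of \<open>H \<union> K\<close>: the
  subgroup generated by the next mixed terms is normal, so the reduction to generators applies.
\<close>

lemma lower_central_join_subset:
  assumes H: "H \<lhd> G" and K: "K \<lhd> G"
  shows "lower_central (G\<lparr>carrier := generate G (H \<union> K)\<rparr>) n \<subseteq>
    generate G (mixed_terms G H K (Suc n))"
proof (induction n)
  have HK: "H \<union> K \<subseteq> carrier G"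
    using H K by (simp add: normal_imp_subgroup subgroup.subset)
  case 0
  have "x \<in> mixed_terms G H K 1" if "x \<in> H" for x
    unfolding mem_mixed_terms
    by (rule exI[of _ 1], rule exI[of _ 0]) (use that HK in \<open>auto simp: extended_series_def\<close>)
  moreover have "x \<in> mixed_terms G H K 1" if "x \<in> K" for x
    unfolding mem_mixed_terms
    by (rule exI[of _ 0], rule exI[of _ 1]) (use that HK in \<open>auto simp: extended_series_def\<close>)
  ultimately have "generate G (H \<union> K) \<subseteq> generate G (mixed_terms G H K 1)"
    by (intro mono_generate) blast
  thus ?case by simp
next
  have HK: "H \<union> K \<subseteq> carrier G"
    using H K by (simp add: normal_imp_subgroup subgroup.subset)
  case (Suc n)
  let ?J = "generate G (H \<union> K)"
  have "lower_central (G\<lparr>carrier := ?J\<rparr>) (Suc n) =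
      commutator_subgroup G (lower_central (G\<lparr>carrier := ?J\<rparr>) n) ?J"
    by (rule lower_central_subgroup_Suc[OF generate_is_subgroup[OF HK]])
  also have "\<dots> \<subseteq> commutator_subgroup G (generate G (mixed_terms G H K (Suc n))) ?J"
    unfolding commutator_subgroup_def using Suc.IH by (intro mono_generate) blast
  also have "\<dots> \<subseteq> generate G (mixed_terms G H K (Suc (Suc n)))"
    using commutator_mixed_terms[OF H K]
    by (intro commutator_subgroup_generate_subset generate_mixed_terms_normal H K
        mixed_terms_subset HK generate.incl)
  finally show ?case .
qed

lemma extended_series_trivial:
  assumes N: "N \<lhd> G" and "lower_central (G\<lparr>carrier := N\<rparr>) m = {\<one>}" and "m < i"
  shows "extended_series G N i = {\<one>}"
proof -
  obtain j where j: "i = Suc j" "m \<le> j"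
    using assms(3) by (cases i) auto
  have "group (G\<lparr>carrier := N\<rparr>)"
    by (rule subgroup_imp_group[OF normal_imp_subgroup[OF N]])
  from group.lower_central_trivial_mono[OF this _ j(2)] show ?thesis
    using assms(2) j(1) by (simp add: extended_series_def)
qed

text \<open>
  Pigeonhole: two indices with sum \<open>h + k + 1\<close> cannot satisfy both \<open>i \<le> h\<close> and \<open>j \<le> k\<close>.
\<close>

lemma lower_central_join_trivial:
  assumes H: "H \<lhd> G" and K: "K \<lhd> G"
    and h: "lower_central (G\<lparr>carrier := H\<rparr>) h = {\<one>}"
    and k: "lower_central (G\<lparr>carrier := K\<rparr>) k = {\<one>}"
  shows "lower_central (G\<lparr>carrier := generate G (H \<union> K)\<rparr>) (h + k) = {\<one>}"
proof -
  have "H \<union> K \<subseteq> carrier G"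
    using H K by (simp add: normal_imp_subgroup subgroup.subset)
  hence J: "group (G\<lparr>carrier := generate G (H \<union> K)\<rparr>)"
    by (intro subgroup_imp_group generate_is_subgroup)
  have "x = \<one>" if x: "x \<in> mixed_terms G H K (Suc (h + k))" for x
  proof -
    obtain i j where ij: "i + j = Suc (h + k)"
      and xH: "x \<in> extended_series G H i" and xK: "x \<in> extended_series G K j"
      using x unfolding mem_mixed_terms by blast
    from ij consider "h < i" | "k < j" by linarith
    thus ?thesis
      using extended_series_trivial[OF H h] extended_series_trivial[OF K k] xH xK by cases auto
  qed
  hence "generate G (mixed_terms G H K (Suc (h + k))) \<subseteq> generate G {\<one>}"
    by (intro mono_generate) blast
  hence "lower_central (G\<lparr>carrier := generate G (H \<union> K)\<rparr>) (h + k) \<subseteq> {\<one>}"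
    using lower_central_join_subset[OF H K, of "h + k"] generate_one by simp
  thus ?thesis
    using subgroup.one_closed[OF group.subgroup_lower_central[OF J, of "h + k"]] by auto
qed

end

lemma lower_central_nilpotency_class:
  assumes "nilpotent_group G"
  shows "lower_central G (nilpotency_class G) = {\<one>\<^bsub>G\<^esub>}"
  using assms unfolding nilpotent_group_def nilpotency_class_def by (metis (mono_tags, lifting) LeastI)

theorem theorem1:
  fixes G :: "('a, 'b) monoid_scheme" (structure) and H K :: "'a set"
  assumes "group G"
    and "H \<lhd> G" and "K \<lhd> G"
    and "nilpotent_group (G\<lparr>carrier := H\<rparr>)"
    and "nilpotent_group (G\<lparr>carrier := K\<rparr>)"
  shows "nilpotent_group (G\<lparr>carrier := generate G (H \<union> K)\<rparr>) \<and>
    (\<forall>h k. nilpotency_class (G\<lparr>carrier := H\<rparr>) = h \<and> nilpotency_class (G\<lparr>carrier := K\<rparr>) = k \<longrightarrow>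
       nilpotency_class (G\<lparr>carrier := generate G (H \<union> K)\<rparr>) \<le> h + k)"
proof -
  interpret group G by (rule assms(1))
  let ?J = "G\<lparr>carrier := generate G (H \<union> K)\<rparr>"
  let ?h = "nilpotency_class (G\<lparr>carrier := H\<rparr>)" and ?k = "nilpotency_class (G\<lparr>carrier := K\<rparr>)"
  have "H \<union> K \<subseteq> carrier G"
    using assms(2,3) by (simp add: normal_imp_subgroup subgroup.subset)
  hence J: "group ?J"
    by (intro subgroup_imp_group generate_is_subgroup)
  have trivial: "lower_central ?J (?h + ?k) = {\<one>\<^bsub>?J\<^esub>}"
    using lower_central_join_trivial[OF assms(2,3)] assms(4,5)[THEN lower_central_nilpotency_class]
    by simp
  hence "nilpotent_group ?J"
    using J unfolding nilpotent_group_def by blast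
  moreover have "nilpotency_class ?J \<le> ?h + ?k"
    unfolding nilpotency_class_def[of ?J] by (rule Least_le) (rule trivial)
  ultimately show ?thesis by simp
qed

end
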